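(* The projective plane $\mathbb{F}_3\mathbf{P}^2$ is homogeneous: every isomorphism between (finite) subspaces of $\mathbb{F}_3\mathbf{P}^2$ extends to an automorphism of $\mathbb{F}_3\mathbf{P}^2$.
   Context: A linear space is a pair $\langle X,\mathcal L\rangle$ where $X$ is a set (of points) and $\mathcal L$ is a family of subsets of $X$ (lines) such that every line has at least two points and any two different points lie on exactly one common line. Points are collinear if some line contains all of them. An isomorphism of linear spaces is a bijection $f$ such that any three pairwise distinct points are collinear if and only if their images are collinear. Any subset $Y\subseteq X$ is a subspace, with lines the sets $L\cap Y$ ($L\in\mathcal L$) having at least two points. $\mathbb{F}_3\mathbf P^2$ is the linear space whose points are the $1$-dimensional subspaces of $\mathbb{F}_3^3$ and whose lines are the $2$-dimensional subspaces of $\mathbb{F}_3^3$ (each identified with the set of $1$-dimensional subspaces it contains), where $\mathbb{F}_3$ is the field with $3$ elements. *)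

theory Defs
  imports "HOL-Analysis.Analysis"
begin

definition linear_space :: "'a set \<Rightarrow> 'a set set \<Rightarrow> bool" where
  "linear_space X \<L> \<longleftrightarrow>
     (\<forall>L\<in>\<L>. L \<subseteq> X \<and> (\<exists>x\<in>L. \<exists>y\<in>L. x \<noteq> y)) \<and>
     (\<forall>x\<in>X. \<forall>y\<in>X. x \<noteq> y \<longrightarrow> (\<exists>!L. L \<in> \<L> \<and> x \<in> L \<and> y \<in> L))"

definition collinear_points :: "'a set set \<Rightarrow> 'a set \<Rightarrow> bool" where
  "collinear_points \<L> A \<longleftrightarrow> (\<exists>L\<in>\<L>. A \<subseteq> L)"

definition subspace_lines :: "'a set set \<Rightarrow> 'a set \<Rightarrow> 'a set set" where
  "subspace_lines \<L> Y = {L \<inter> Y | L. L \<in> \<L> \<and> (\<exists>x \<in> L \<inter> Y. \<exists>y \<in> L \<inter> Y. x \<noteq> y)}"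

text \<open>Isomorphisms are total HOL functions of which only the values on the point set
  of the domain matter.\<close>

definition linear_space_iso ::
    "'a set \<Rightarrow> 'a set set \<Rightarrow> 'b set \<Rightarrow> 'b set set \<Rightarrow> ('a \<Rightarrow> 'b) \<Rightarrow> bool" where
  "linear_space_iso X \<L> Y \<M> f \<longleftrightarrow>
     bij_betw f X Y \<and>
     (\<forall>x\<in>X. \<forall>y\<in>X. \<forall>z\<in>X. x \<noteq> y \<and> y \<noteq> z \<and> x \<noteq> z \<longrightarrow>
        (collinear_points \<L> {x, y, z} \<longleftrightarrow> collinear_points \<M> {f x, f y, f z}))"

definition homogeneous_linear_space :: "'a set \<Rightarrow> 'a set set \<Rightarrow> bool" where
  "homogeneous_linear_space X \<L> \<longleftrightarrow>
     (\<forall>Y Z f. Y \<subseteq> X \<and> finite Y \<and> Z \<subseteq> X \<and> finite Z \<and>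
        linear_space_iso Y (subspace_lines \<L> Y) Z (subspace_lines \<L> Z) f \<longrightarrow>
        (\<exists>g. linear_space_iso X \<L> X \<L> g \<and> (\<forall>y\<in>Y. g y = f y)))"

text \<open>The library makes the three-element type \<open>finite_3\<close> a field, with elements
  \<open>a\<^sub>1 = 0\<close>, \<open>a\<^sub>2 = 1\<close>, \<open>a\<^sub>3 = 2\<close> and arithmetic modulo 3. In \<open>F3 ^ 3\<close> the exponent
  is the three-element index type.\<close>

type_synonym F3 = Enum.finite_3

lemma card_F3: "CARD(F3) = 3"
  by (simp add: Enum.UNIV_finite_3)

definition F3P2_points :: "(F3 ^ 3) set set" where
  "F3P2_points = {p. vec.subspace p \<and> vec.dim p = 1}"

definition F3P2_lines :: "(F3 ^ 3) set set set" where
  "F3P2_lines = {{p \<in> F3P2_points. p \<subseteq> W} | W. vec.subspace W \<and> vec.dim W = 2}"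

lemma linear_space_subspace:
  assumes "linear_space X \<L>" and "Y \<subseteq> X"
  shows "linear_space Y (subspace_lines \<L> Y)"
  unfolding linear_space_def
proof (intro conjI ballI impI)
  fix L assume "L \<in> subspace_lines \<L> Y"
  then show "L \<subseteq> Y" "\<exists>x\<in>L. \<exists>y\<in>L. x \<noteq> y"
    unfolding subspace_lines_def by auto
next
  fix x y assume xy: "x \<in> Y" "y \<in> Y" "x \<noteq> y"
  then have "x \<in> X" "y \<in> X" using assms(2) by auto
  then have "\<exists>!L. L \<in> \<L> \<and> x \<in> L \<and> y \<in> L"
    using assms(1) xy(3) unfolding linear_space_def by simp
  then obtain L where L: "L \<in> \<L>" "x \<in> L" "y \<in> L"
    and uniq: "\<And>L'. L' \<in> \<L> \<Longrightarrow> x \<in> L' \<Longrightarrow> y \<in> L' \<Longrightarrow> L' = L"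
    by blast
  show "\<exists>!K. K \<in> subspace_lines \<L> Y \<and> x \<in> K \<and> y \<in> K"
  proof (rule ex1I[of _ "L \<inter> Y"])
    show "L \<inter> Y \<in> subspace_lines \<L> Y \<and> x \<in> L \<inter> Y \<and> y \<in> L \<inter> Y"
      using L xy unfolding subspace_lines_def by blast
  next
    fix K assume "K \<in> subspace_lines \<L> Y \<and> x \<in> K \<and> y \<in> K"
    then show "K = L \<inter> Y"
      using uniq unfolding subspace_lines_def by blast
  qed
qed

lemma F3P2_point_span:
  assumes "p \<in> F3P2_points"
  obtains u where "u \<noteq> 0" "p = vec.span {u}"
proof -
  from assms have p: "vec.subspace p" "vec.dim p = 1"
    by (auto simp: F3P2_points_def)
  obtain B where B: "B \<subseteq> p" "vec.independent B" "p \<subseteq> vec.span B" "card B = vec.dim p"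
    using vec.basis_exists by blast
  with p obtain u where u: "B = {u}"
    by (metis card_1_singletonE)
  have "u \<noteq> 0" using B(2) u vec.dependent_zero by blast
  moreover have "p = vec.span {u}"
    using B(1,3) u vec.span_minimal[OF B(1) p(1)] by simp
  ultimately show ?thesis by (rule that)
qed

lemma F3P2_span_point: "u \<noteq> 0 \<Longrightarrow> vec.span {u} \<in> F3P2_points"
  by (simp add: F3P2_points_def)

lemma linear_space_F3P2: "linear_space F3P2_points F3P2_lines"
  unfolding linear_space_def
proof (intro conjI ballI impI)
  fix L assume "L \<in> F3P2_lines"
  then obtain W where W: "vec.subspace W" "vec.dim W = 2" and L: "L = {p \<in> F3P2_points. p \<subseteq> W}"
    unfolding F3P2_lines_def by blast
  show "L \<subseteq> F3P2_points" using L by blast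
  obtain B where B: "B \<subseteq> W" "vec.independent B" "W \<subseteq> vec.span B" "card B = vec.dim W"
    using vec.basis_exists by blast
  then have "card B = 2" using W(2) by simp
  then obtain u v where uv: "B = {u, v}" "u \<noteq> v"
    unfolding card_2_iff by blast
  have nz: "u \<noteq> 0" "v \<noteq> 0" using B(2) uv(1) vec.dependent_zero[of B] by auto
  have "u \<in> W" "v \<in> W" using B(1) uv by auto
  then have "vec.span {u} \<subseteq> W" "vec.span {v} \<subseteq> W"
    using W(1) by (simp_all add: vec.span_minimal)
  then have "vec.span {u} \<in> L" "vec.span {v} \<in> L"
    using L nz F3P2_span_point by simp_all
  moreover have "vec.span {u} \<noteq> vec.span {v}"
  proof
    assume "vec.span {u} = vec.span {v}"
    then have "u \<in> vec.span {v}" using vec.span_base[of u "{u}"] by simp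
    then show False using B(2) uv by (simp add: vec.independent_insert)
  qed
  ultimately show "\<exists>x\<in>L. \<exists>y\<in>L. x \<noteq> y" by blast
next
  fix p q assume pq: "p \<in> F3P2_points" "q \<in> F3P2_points" "p \<noteq> q"
  obtain u where u: "u \<noteq> 0" "p = vec.span {u}" using pq(1) by (rule F3P2_point_span)
  obtain v where v: "v \<noteq> 0" "q = vec.span {v}" using pq(2) by (rule F3P2_point_span)
  have "v \<notin> vec.span {u}"
  proof
    assume "v \<in> vec.span {u}"
    then have "q \<subseteq> p" unfolding u(2) v(2) by (simp add: vec.span_minimal)
    then have "q = p" using pq unfolding F3P2_points_def
      by (intro vec.subspace_dim_equal) auto
    then show False using pq by simp
  qed
  then have dimW: "vec.dim (vec.span {v, u}) = 2"
    using u(1) by (simp add: vec.dim_insert)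
  let ?W = "vec.span {v, u}"
  have sub: "p \<subseteq> ?W" "q \<subseteq> ?W" unfolding u(2) v(2) by (rule vec.span_mono, simp)+
  show "\<exists>!L. L \<in> F3P2_lines \<and> p \<in> L \<and> q \<in> L"
  proof (rule ex1I[of _ "{r \<in> F3P2_points. r \<subseteq> ?W}"])
    show "{r \<in> F3P2_points. r \<subseteq> ?W} \<in> F3P2_lines \<and>
        p \<in> {r \<in> F3P2_points. r \<subseteq> ?W} \<and> q \<in> {r \<in> F3P2_points. r \<subseteq> ?W}"
      using dimW sub pq unfolding F3P2_lines_def by blast
  next
    fix L assume A: "L \<in> F3P2_lines \<and> p \<in> L \<and> q \<in> L"
    then obtain W where W: "vec.subspace W" "vec.dim W = 2" and L: "L = {r \<in> F3P2_points. r \<subseteq> W}"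
      unfolding F3P2_lines_def by blast
    have "p \<subseteq> W" "q \<subseteq> W" using A L by auto
    then have "u \<in> W" "v \<in> W" unfolding u(2) v(2) using vec.span_base by auto
    then have "?W \<subseteq> W" using W(1) by (simp add: vec.span_minimal)
    then have "?W = W" using W dimW by (intro vec.subspace_dim_equal) auto
    then show "L = {r \<in> F3P2_points. r \<subseteq> ?W}" using L by simp
  qed
qed

end

theory Submission
  imports Defs
begin

text \<open>
  A partial isomorphism is extended to an automorphism induced by an invertible matrix.

  First, the domain may be assumed not to lie on a line. If it does, so does its image, and any
  point off the first line can be sent to any point off the second line, because no new collinear
  triples arise. This works in every finite linear space whose points do not all lie on one line
  (\<open>partial_iso_extend_noncollinear\<close>).

  A noncollinear domain contains a triangle. Collinearity of points is the vanishing of a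
  determinant (\<open>collinear_iff_det\<close>), and the vectors that span the triangle may be rescaled, so
  there are coordinate systems for the domain and the image in which the partial
  isomorphism fixes the three basis points and one further point \<open>z\<close> with coordinates 0 and 1
  (\<open>matched_frames\<close>). It remains to see that it fixes, in these coordinates, all other points of
  its domain, provided that the fourth point is well chosen; then the change of coordinates is the
  required matrix.

  If the domain contains a quadrangle, \<open>z\<close> is \<open>(1, 1, 1)\<close>. The six lines joining two of the
  four points are the lines where a coordinate vanishes or two coordinates agree. Over the field
  with three elements, the zeros and the equalities among the coordinates determine a point
  (\<open>pt_eq_of_coords\<close>), so collinearity with the quadrangle determines every point of the plane.
  If the domain contains no quadrangle, it is a triangle, where nothing remains to be
  shown, or it consists of at least three points of a line and one point off that line. In the last
  case \<open>z\<close> is chosen on the line, as \<open>(1, 1, 0)\<close>, and determines the one remaining point of the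
  line in the same way.
\<close>

section \<open>Partial isomorphisms of linear spaces\<close>

text \<open>An isomorphism between two subspaces, read inside the ambient space: collinearity in the
  subspaces is replaced by collinearity in \<open>X\<close>, and the image remains implicit, so that the
  domain can be enlarged by updating \<open>f\<close> at one point.\<close>

definition partial_iso :: "'a set \<Rightarrow> 'a set set \<Rightarrow> 'a set \<Rightarrow> ('a \<Rightarrow> 'a) \<Rightarrow> bool" where
  "partial_iso X \<L> Y f \<longleftrightarrow> Y \<subseteq> X \<and> f ` Y \<subseteq> X \<and> inj_on f Y \<and>
     (\<forall>x\<in>Y. \<forall>y\<in>Y. \<forall>z\<in>Y. x \<noteq> y \<and> y \<noteq> z \<and> x \<noteq> z \<longrightarrow>
        (collinear_points \<L> {x, y, z} \<longleftrightarrow> collinear_points \<L> {f x, f y, f z}))"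

lemma collinear_points_subspace_lines:
  assumes "x \<in> Y" "y \<in> Y" "z \<in> Y" "x \<noteq> y"
  shows "collinear_points (subspace_lines \<L> Y) {x, y, z} \<longleftrightarrow> collinear_points \<L> {x, y, z}"
proof
  assume "collinear_points (subspace_lines \<L> Y) {x, y, z}"
  then show "collinear_points \<L> {x, y, z}"
    unfolding collinear_points_def subspace_lines_def by blast
next
  assume "collinear_points \<L> {x, y, z}"
  then obtain L where "L \<in> \<L>" "{x, y, z} \<subseteq> L"
    unfolding collinear_points_def by blast
  then have "L \<inter> Y \<in> subspace_lines \<L> Y" "{x, y, z} \<subseteq> L \<inter> Y"
    using assms unfolding subspace_lines_def by blast+
  then show "collinear_points (subspace_lines \<L> Y) {x, y, z}"
    unfolding collinear_points_def by blast
qed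

lemma linear_space_iso_imp_partial_iso:
  assumes "Y \<subseteq> X" "Z \<subseteq> X"
    and "linear_space_iso Y (subspace_lines \<L> Y) Z (subspace_lines \<L> Z) f"
  shows "partial_iso X \<L> Y f"
proof -
  have f: "inj_on f Y" "f ` Y = Z"
    using assms(3) unfolding linear_space_iso_def bij_betw_def by auto
  have "collinear_points \<L> {x, y, z} \<longleftrightarrow> collinear_points \<L> {f x, f y, f z}"
    if xyz: "x \<in> Y" "y \<in> Y" "z \<in> Y" "x \<noteq> y" "y \<noteq> z" "x \<noteq> z" for x y z
  proof -
    have "f x \<in> Z" "f y \<in> Z" "f z \<in> Z" "f x \<noteq> f y"
      using f xyz by (auto dest: inj_onD)
    then show ?thesis
      using assms(3) xyz collinear_points_subspace_lines[of x Y y z \<L>]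
        collinear_points_subspace_lines[of "f x" Z "f y" "f z" \<L>]
      unfolding linear_space_iso_def by blast
  qed
  then show ?thesis
    using assms f unfolding partial_iso_def by blast
qed

text \<open>With \<open>x = y\<close> allowed, this also says that every single point lies on a line: a line has
  two points, so there is a second point to join to \<open>x\<close>.\<close>

lemma collinear_pair:
  assumes "linear_space X \<L>" "\<L> \<noteq> {}" "x \<in> X" "y \<in> X"
  shows "collinear_points \<L> {x, y}"
proof -
  obtain L where "L \<in> \<L>" using assms(2) by blast
  then have L: "L \<subseteq> X" "\<exists>u\<in>L. \<exists>v\<in>L. u \<noteq> v"
    using assms(1) unfolding linear_space_def by auto
  obtain w where w: "w \<in> X" "w \<noteq> x" "x = y \<or> w = y"
  proof (cases "x = y")
    case True
    with L that show ?thesis by (metis subsetD)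
  next
    case False
    with that assms(4) show ?thesis by metis
  qed
  have "\<exists>!L. L \<in> \<L> \<and> x \<in> L \<and> w \<in> L"
    using assms(1,3) w unfolding linear_space_def by blast
  with w(3) show ?thesis
    unfolding collinear_points_def by auto
qed

text \<open>Two points of \<open>Y\<close> already fix the only line that can contain \<open>Y\<close>. Contrapositively, a set
  that lies on no line contains a triangle.\<close>

lemma collinear_of_triples:
  assumes ls: "linear_space X \<L>" "\<L> \<noteq> {}" and "Y \<subseteq> X"
    and triples: "\<And>x y z. x \<in> Y \<Longrightarrow> y \<in> Y \<Longrightarrow> z \<in> Y \<Longrightarrow> x \<noteq> y \<Longrightarrow> y \<noteq> z \<Longrightarrow> x \<noteq> z \<Longrightarrow>
      collinear_points \<L> {x, y, z}"
  shows "collinear_points \<L> Y"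
proof (cases "\<exists>x\<in>Y. \<exists>y\<in>Y. x \<noteq> y")
  case True
  then obtain x y where xy: "x \<in> Y" "y \<in> Y" "x \<noteq> y" by blast
  then have "\<exists>!L. L \<in> \<L> \<and> x \<in> L \<and> y \<in> L"
    using ls(1) \<open>Y \<subseteq> X\<close> unfolding linear_space_def by blast
  then obtain L where L: "L \<in> \<L>" "x \<in> L" "y \<in> L"
    and uniq: "\<And>L'. L' \<in> \<L> \<Longrightarrow> x \<in> L' \<Longrightarrow> y \<in> L' \<Longrightarrow> L' = L" by blast
  have "z \<in> L" if z: "z \<in> Y" for z
  proof (cases "z = x \<or> z = y")
    case False
    then have "collinear_points \<L> {x, y, z}" using triples xy z by metis
    then obtain L' where "L' \<in> \<L>" "x \<in> L'" "y \<in> L'" "z \<in> L'"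
      unfolding collinear_points_def by auto
    then show ?thesis using uniq by metis
  qed (use L in blast)
  with L(1) show ?thesis unfolding collinear_points_def by blast
next
  case False
  show ?thesis
  proof (cases "Y = {}")
    case True
    with ls(2) show ?thesis unfolding collinear_points_def by blast
  next
    case nonempty: False
    then obtain y where "Y = {y}" using False by blast
    then show ?thesis using collinear_pair[OF ls, of y y] \<open>Y \<subseteq> X\<close> by simp
  qed
qed

lemma partial_iso_collinear_image:
  assumes "linear_space X \<L>" "partial_iso X \<L> Y f" "collinear_points \<L> Y"
  shows "collinear_points \<L> (f ` Y)"
proof (rule collinear_of_triples[OF assms(1)])
  show "\<L> \<noteq> {}" using assms(3) unfolding collinear_points_def by blast
  show "f ` Y \<subseteq> X" using assms(2) unfolding partial_iso_def by blast
  fix x y z assume "x \<in> f ` Y" "y \<in> f ` Y" "z \<in> f ` Y" "x \<noteq> y" "y \<noteq> z" "x \<noteq> z"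
  then obtain x' y' z' where xyz: "x = f x'" "y = f y'" "z = f z'"
    "x' \<in> Y" "y' \<in> Y" "z' \<in> Y" "x' \<noteq> y'" "y' \<noteq> z'" "x' \<noteq> z'" by blast
  moreover have "collinear_points \<L> {x', y', z'}"
    using assms(3) xyz unfolding collinear_points_def by blast
  ultimately show "collinear_points \<L> {x, y, z}"
    using assms(2) unfolding partial_iso_def by blast
qed

lemma not_collinear_off_line:
  assumes "linear_space X \<L>" "L \<in> \<L>" "x \<in> L" "y \<in> L" "x \<noteq> y" "p \<notin> L"
  shows "\<not> collinear_points \<L> {x, y, p}"
proof
  assume "collinear_points \<L> {x, y, p}"
  then obtain L' where "L' \<in> \<L>" "x \<in> L'" "y \<in> L'" "p \<in> L'"
    unfolding collinear_points_def by blast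
  moreover have "x \<in> X" "y \<in> X" using assms unfolding linear_space_def by blast+
  ultimately have "L' = L" using assms unfolding linear_space_def by metis
  with \<open>p \<in> L'\<close> \<open>p \<notin> L\<close> show False by simp
qed

text \<open>Both \<open>Y\<close> and \<open>f ` Y\<close> lie on lines. A new point \<open>p\<close> off the first line may be sent to any
  point \<open>q\<close> off the second: the new triples consist of \<open>p\<close> and two points of \<open>Y\<close>, and they are
  noncollinear on both sides.\<close>

lemma partial_iso_extend_point:
  assumes ls: "linear_space X \<L>" and X: "\<not> collinear_points \<L> X"
    and f: "partial_iso X \<L> Y f" and Y: "collinear_points \<L> Y"
  obtains p q where "p \<in> X - Y" "partial_iso X \<L> (insert p Y) (f(p := q))"
proof -
  obtain L where L: "L \<in> \<L>" "Y \<subseteq> L" using Y unfolding collinear_points_def by blast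
  obtain M where M: "M \<in> \<L>" "f ` Y \<subseteq> M"
    using partial_iso_collinear_image[OF ls f Y] unfolding collinear_points_def by blast
  obtain p where p: "p \<in> X" "p \<notin> L" using X L unfolding collinear_points_def by blast
  obtain q where q: "q \<in> X" "q \<notin> M" using X M unfolding collinear_points_def by blast
  have fY: "Y \<subseteq> X" "f ` Y \<subseteq> X" "inj_on f Y" using f unfolding partial_iso_def by auto
  let ?g = "f(p := q)"
  have pY: "p \<notin> Y" and g: "?g p = q" "\<And>y. y \<in> Y \<Longrightarrow> ?g y = f y" using p L by auto
  have off: "\<not> collinear_points \<L> {x, y, p} \<and> \<not> collinear_points \<L> {f x, f y, q}"
    if "x \<in> Y" "y \<in> Y" "x \<noteq> y" for x y
  proof
    show "\<not> collinear_points \<L> {x, y, p}"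
      using not_collinear_off_line[OF ls L(1) _ _ _ p(2)] that L(2) by blast
    have "f x \<noteq> f y" using fY that by (auto dest: inj_onD)
    then show "\<not> collinear_points \<L> {f x, f y, q}"
      using not_collinear_off_line[OF ls M(1) _ _ _ q(2)] that M(2) by blast
  qed
  have "partial_iso X \<L> (insert p Y) ?g"
    unfolding partial_iso_def
  proof (intro conjI ballI impI)
    show "insert p Y \<subseteq> X" using p fY by blast
    show "?g ` insert p Y \<subseteq> X" using q fY by auto
    show "inj_on ?g (insert p Y)"
      using fY pY q M unfolding inj_on_def by auto
    fix x y z assume xyz: "x \<in> insert p Y" "y \<in> insert p Y" "z \<in> insert p Y"
      "x \<noteq> y \<and> y \<noteq> z \<and> x \<noteq> z"
    consider "x = p" "y \<in> Y" "z \<in> Y" | "y = p" "x \<in> Y" "z \<in> Y" | "z = p" "x \<in> Y" "y \<in> Y"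
      | "x \<in> Y" "y \<in> Y" "z \<in> Y" using xyz by blast
    then show "collinear_points \<L> {x, y, z} = collinear_points \<L> {?g x, ?g y, ?g z}"
    proof cases
      case 1
      then have "{x, y, z} = {y, z, p}" "{?g x, ?g y, ?g z} = {f y, f z, q}"
        using g pY by auto
      then show ?thesis using off[of y z] 1 xyz by simp
    next
      case 2
      then have "{x, y, z} = {x, z, p}" "{?g x, ?g y, ?g z} = {f x, f z, q}"
        using g pY by auto
      then show ?thesis using off[of x z] 2 xyz by simp
    next
      case 3
      then have "{x, y, z} = {x, y, p}" "{?g x, ?g y, ?g z} = {f x, f y, q}"
        using g pY by auto
      then show ?thesis using off[of x y] 3 xyz by simp
    next
      case 4
      then show ?thesis using f g xyz unfolding partial_iso_def by simp
    qed
  qed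
  then show ?thesis using that p(1) pY by blast
qed

text \<open>Repeated extension off the line. As \<open>X\<close> itself is not collinear, the process cannot
  end with a collinear domain.\<close>

lemma partial_iso_extend_noncollinear:
  assumes ls: "linear_space X \<L>" and X: "\<not> collinear_points \<L> X" "finite X"
    and f: "partial_iso X \<L> Y f"
  shows "\<exists>Y' f'. Y \<subseteq> Y' \<and> (\<forall>y\<in>Y. f' y = f y) \<and> partial_iso X \<L> Y' f' \<and> \<not> collinear_points \<L> Y'"
  using f
proof (induction "card (X - Y)" arbitrary: Y f rule: less_induct)
  case less
  show ?case
  proof (cases "collinear_points \<L> Y")
    case True
    obtain p q where p: "p \<in> X - Y" and g: "partial_iso X \<L> (insert p Y) (f(p := q))"
      using partial_iso_extend_point[OF ls X(1) less.prems True] by blast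
    have "card (X - insert p Y) < card (X - Y)"
      using p X(2) by (intro psubset_card_mono) auto
    from less.hyps[OF this g] obtain Y' f' where
      Y': "insert p Y \<subseteq> Y'" "\<forall>y\<in>insert p Y. f' y = (f(p := q)) y"
      "partial_iso X \<L> Y' f'" "\<not> collinear_points \<L> Y'" by blast
    moreover have "\<forall>y\<in>Y. f' y = f y" using Y'(2) p by auto
    ultimately show ?thesis by blast
  qed (use less.prems in blast)
qed

section \<open>Points, determinants and matrices\<close>

text \<open>These equations unfold \<open>0\<close> and \<open>1\<close> of the three-element field into constructors, which
  hides them from the ring and field simplification rules.\<close>

declare zero_finite_3_def [simp del] one_finite_3_def [simp del]

abbreviation pt :: "'a::field ^ 'n \<Rightarrow> ('a ^ 'n) set" where
  "pt u \<equiv> vec.span {u}"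

abbreviation det3 :: "'a::field ^ 3 \<Rightarrow> 'a ^ 3 \<Rightarrow> 'a ^ 3 \<Rightarrow> 'a" where
  "det3 u v w \<equiv> det (vector [u, v, w])"

abbreviation col :: "(F3 ^ 3) set \<Rightarrow> (F3 ^ 3) set \<Rightarrow> (F3 ^ 3) set \<Rightarrow> bool" where
  "col p q r \<equiv> collinear_points F3P2_lines {p, q, r}"

lemma F3P2_lines_nonempty: "F3P2_lines \<noteq> {}"
proof -
  have "(2::nat) \<le> vec.dim (UNIV :: (F3 ^ 3) set)" by (simp add: card_cart_basis)
  then obtain W :: "(F3 ^ 3) set" where "vec.subspace W" "vec.dim W = 2"
    using vec.choose_subspace_of_subspace[of 2 UNIV] by auto
  then show ?thesis unfolding F3P2_lines_def by blast
qed

text \<open>Three vectors in a plane are combinations of two vectors, so their determinant vanishes.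
  Conversely, a vanishing determinant gives a linear relation with some nonzero coefficient; the
  vector at that coefficient lies in every plane through the other two. The two other points
  may coincide, and then any line through them serves.\<close>

lemma collinear_iff_det:
  fixes u v w :: "F3 ^ 3"
  assumes "u \<noteq> 0" "v \<noteq> 0" "w \<noteq> 0"
  shows "col (pt u) (pt v) (pt w) \<longleftrightarrow> det3 u v w = 0"
proof
  assume "col (pt u) (pt v) (pt w)"
  then obtain W where W: "vec.subspace W" "vec.dim W = 2"
    and "pt u \<subseteq> W" "pt v \<subseteq> W" "pt w \<subseteq> W"
    unfolding collinear_points_def F3P2_lines_def by auto
  then have uvw: "u \<in> W" "v \<in> W" "w \<in> W" using vec.span_base by blast+
  obtain B where B: "B \<subseteq> W" "W \<subseteq> vec.span B" "card B = 2"
    using vec.basis_exists[of W] W(2) by metis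
  then obtain a b where "B = {a, b}" unfolding card_2_iff by blast
  have "\<exists>k l. x = k *s a + l *s b" if x: "x \<in> W" for x
  proof -
    obtain k l where "x - k *s a = l *s b"
      using subsetD[OF B(2) x]
      unfolding \<open>B = {a, b}\<close> vec.span_breakdown_eq[of _ a] vec.span_singleton by blast
    then have "x = k *s a + l *s b" by (simp add: diff_eq_eq add.commute)
    then show ?thesis by blast
  qed
  then obtain k l k' l' k'' l'' where
    "u = k *s a + l *s b" "v = k' *s a + l' *s b" "w = k'' *s a + l'' *s b"
    using uvw by metis
  then show "det3 u v w = 0"
    by (simp add: det_3 algebra_simps)
next
  assume "det3 u v w = 0"
  then have "\<not> invertible (vector [u, v, w] :: F3 ^ 3 ^ 3)"
    by (simp add: invertible_det_nz)
  then obtain c i where "(\<Sum>i\<in>UNIV. c i *s row i (vector [u, v, w] :: F3 ^ 3 ^ 3)) = 0"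
    "c i \<noteq> 0"
    unfolding invertible_right_inverse matrix_right_invertible_independent_rows by blast
  then have c: "c 1 *s u + c 2 *s v + c 3 *s w = 0" "c 1 \<noteq> 0 \<or> c 2 \<noteq> 0 \<or> c 3 \<noteq> 0"
    using exhaust_3[of i] by (auto simp: sum_3 row_def)
  have *: "col (pt x) (pt y) (pt z)"
    if "y \<noteq> 0" "z \<noteq> 0" "x \<noteq> 0" "k *s x + l *s y + m *s z = 0" "k \<noteq> 0" for x y z k l m
  proof -
    have "collinear_points F3P2_lines {pt y, pt z}"
      using that F3P2_span_point by (intro collinear_pair[OF linear_space_F3P2 F3P2_lines_nonempty])
    then obtain W where W: "vec.subspace W" "vec.dim W = 2" "pt y \<subseteq> W" "pt z \<subseteq> W"
      unfolding collinear_points_def F3P2_lines_def by auto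
    then have yz: "y \<in> W" "z \<in> W" using vec.span_base by blast+
    have "- (l *s y + m *s z) \<in> W"
      using W(1) yz by (intro vec.subspace_neg vec.subspace_add vec.subspace_scale)
    moreover have "k *s x = - (l *s y + m *s z)"
      using that(4) by (metis add.assoc eq_neg_iff_add_eq_0)
    ultimately have "inverse k *s (k *s x) \<in> W"
      using W(1) vec.subspace_scale by metis
    then have "x \<in> W" using that(5) by simp
    then have "pt x \<subseteq> W" using W(1) by (simp add: vec.span_minimal)
    then have "{pt x, pt y, pt z} \<subseteq> {p \<in> F3P2_points. p \<subseteq> W}"
      using W that(1-3) F3P2_span_point by simp
    moreover have "{p \<in> F3P2_points. p \<subseteq> W} \<in> F3P2_lines"
      using W(1,2) unfolding F3P2_lines_def by blast
    ultimately show ?thesis unfolding collinear_points_def by (rule bexI)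
  qed
  from c(2) show "col (pt u) (pt v) (pt w)"
  proof (elim disjE)
    assume "c 1 \<noteq> 0"
    then show ?thesis using *[of v w u] c(1) assms by simp
  next
    assume "c 2 \<noteq> 0"
    then have "col (pt v) (pt u) (pt w)"
      using *[of u w v "c 2" "c 1" "c 3"] c(1) assms by (simp add: ac_simps)
    then show ?thesis by (simp add: insert_commute)
  next
    assume "c 3 \<noteq> 0"
    then have "col (pt w) (pt u) (pt v)"
      using *[of u v w "c 3" "c 1" "c 2"] c(1) assms by (simp add: ac_simps)
    then show ?thesis by (simp add: insert_commute)
  qed
qed

lemma det3_matrix:
  fixes M :: "'a::field ^ 3 ^ 3"
  shows "det3 (M *v x) (M *v y) (M *v z) = det M * det3 x y z"
proof -
  have "(vector [M *v x, M *v y, M *v z] :: 'a ^ 3 ^ 3) = vector [x, y, z] ** transpose M"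
    by (simp add: vec_eq_iff forall_3 matrix_matrix_mult_def matrix_vector_mult_def
        transpose_def sum_3 mult.commute)
  then show ?thesis by (simp add: det_mul mult.commute)
qed

lemma matrix_pt:
  fixes M :: "'a::field ^ 'n ^ 'n"
  shows "(*v) M ` pt x = pt (M *v x)"
  unfolding vec.span_singleton by (simp add: image_image vector_scalar_commute)

lemma invertible_mult_eq_0:
  fixes M :: "'a::field ^ 'n ^ 'n"
  assumes "invertible M"
  shows "M *v x = 0 \<longleftrightarrow> x = 0"
proof
  assume "M *v x = 0"
  obtain N where "N ** M = mat 1" using assms unfolding invertible_def by blast
  then have "x = N *v (M *v x)" by (simp add: matrix_vector_mul_assoc)
  with \<open>M *v x = 0\<close> show "x = 0" by simp
qed simp

lemma collinear_matrix:
  fixes M :: "F3 ^ 3 ^ 3"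
  assumes "invertible M" "x \<noteq> 0" "y \<noteq> 0" "z \<noteq> 0"
  shows "col (pt (M *v x)) (pt (M *v y)) (pt (M *v z)) \<longleftrightarrow> det3 x y z = 0"
  using assms
  by (simp add: collinear_iff_det invertible_mult_eq_0 det3_matrix invertible_det_nz)

text \<open>An invertible matrix multiplies all determinants by the same nonzero factor, so it
  preserves collinearity in both directions.\<close>

lemma matrix_automorphism:
  fixes M :: "F3 ^ 3 ^ 3"
  assumes M: "invertible M"
  shows "linear_space_iso F3P2_points F3P2_lines F3P2_points F3P2_lines (image ((*v) M))"
  unfolding linear_space_iso_def
proof (intro conjI ballI impI)
  obtain N where N: "M ** N = mat 1" "N ** M = mat 1"
    using M unfolding invertible_def by blast
  have inv: "M *v (N *v x) = x" "N *v (M *v x) = x" for x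
    by (simp_all add: matrix_vector_mul_assoc N)
  have "invertible N" using N unfolding invertible_def by blast
  then have "(*v) A ` p \<in> F3P2_points" if "p \<in> F3P2_points" "A = M \<or> A = N" for A p
    using that M by (elim F3P2_point_span)
      (auto simp: matrix_pt invertible_mult_eq_0 intro!: F3P2_span_point)
  then show "bij_betw (image ((*v) M)) F3P2_points F3P2_points"
    by (intro bij_betwI[where g = "image ((*v) N)"])
      (auto simp: image_image inv)
  fix p q r assume "p \<in> F3P2_points" "q \<in> F3P2_points" "r \<in> F3P2_points"
  then obtain x y z where "x \<noteq> 0" "p = pt x" "y \<noteq> 0" "q = pt y" "z \<noteq> 0" "r = pt z"
    by (metis F3P2_point_span)
  then show "col p q r \<longleftrightarrow> col ((*v) M ` p) ((*v) M ` q) ((*v) M ` r)"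
    using M by (simp add: matrix_pt collinear_matrix collinear_iff_det)
qed

abbreviation e1 :: "F3 ^ 3" where "e1 \<equiv> vector [1, 0, 0]"
abbreviation e2 :: "F3 ^ 3" where "e2 \<equiv> vector [0, 1, 0]"
abbreviation e3 :: "F3 ^ 3" where "e3 \<equiv> vector [0, 0, 1]"

lemma vec3_eq_iff: "(x :: F3 ^ 3) = y \<longleftrightarrow> x $ 1 = y $ 1 \<and> x $ 2 = y $ 2 \<and> x $ 3 = y $ 3"
  by (simp add: vec_eq_iff forall_3)

lemma pt_scale:
  fixes u :: "'a::field ^ 'n"
  assumes "k \<noteq> 0"
  shows "pt (k *s u) = pt u"
proof -
  have "u = inverse k *s (k *s u)" using assms by simp
  then have "u \<in> pt (k *s u)" unfolding vec.span_singleton by blast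
  moreover have "k *s u \<in> pt u" unfolding vec.span_singleton by blast
  ultimately show ?thesis
    by (meson empty_subsetI insert_subset subset_antisym vec.span_minimal vec.subspace_span)
qed

text \<open>Three noncollinear points are spanned by a basis, and each basis vector may be rescaled
  without changing its point. The nonzero coordinates of a fourth point can therefore be normalised
  to 1. The normalised vector records only which coordinates are nonzero, that is, which of the
  sides of the triangle \<open>a, b, c\<close> contain \<open>d\<close>.\<close>

lemma adapted_frame:
  assumes abcd: "a \<in> F3P2_points" "b \<in> F3P2_points" "c \<in> F3P2_points" "d \<in> F3P2_points"
    and "\<not> col a b c"
  obtains M z where "invertible M" "a = pt (M *v e1)" "b = pt (M *v e2)" "c = pt (M *v e3)"
    "d = pt (M *v z)" "z \<noteq> 0" "\<And>i. z $ i = 0 \<or> z $ i = 1"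
proof -
  obtain u where u: "u \<noteq> 0" "a = pt u" using abcd(1) by (rule F3P2_point_span)
  obtain v where v: "v \<noteq> 0" "b = pt v" using abcd(2) by (rule F3P2_point_span)
  obtain w where w: "w \<noteq> 0" "c = pt w" using abcd(3) by (rule F3P2_point_span)
  obtain t where t: "t \<noteq> 0" "d = pt t" using abcd(4) by (rule F3P2_point_span)
  have det: "det3 u v w \<noteq> 0" using assms(5) u v w by (simp add: collinear_iff_det)
  define A where "A = transpose (vector [u, v, w] :: F3 ^ 3 ^ 3)"
  have "invertible A" using det by (simp add: A_def invertible_det_nz)
  then obtain N where "A ** N = mat 1" unfolding invertible_def by blast
  then have "A *v (N *v t) = t" by (simp add: matrix_vector_mul_assoc)
  then obtain s where "A *v s = t" by blast
  then have s: "t = s $ 1 *s u + s $ 2 *s v + s $ 3 *s w"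
    by (simp add: A_def vec_eq_iff matrix_vector_mult_def transpose_def sum_3 mult.commute)
  \<comment> \<open>A basis vector on which \<open>t\<close> does not depend is not rescaled, since scaling it by its
    coordinate 0 would destroy the basis.\<close>
  define \<sigma> where "\<sigma> i = (if s $ i = 0 then 1 else s $ i)" for i
  have \<sigma>: "\<sigma> i \<noteq> 0" for i by (simp add: \<sigma>_def)
  define M where "M = transpose (vector [\<sigma> 1 *s u, \<sigma> 2 *s v, \<sigma> 3 *s w] :: F3 ^ 3 ^ 3)"
  have M: "M *v x = (x $ 1 * \<sigma> 1) *s u + (x $ 2 * \<sigma> 2) *s v + (x $ 3 * \<sigma> 3) *s w" for x
    by (simp add: M_def vec_eq_iff matrix_vector_mult_def transpose_def sum_3 ac_simps)
  define z :: "F3 ^ 3" where "z = (\<chi> i. if s $ i = 0 then 0 else 1)"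
  have "z $ i * \<sigma> i = s $ i" for i by (simp add: z_def \<sigma>_def)
  then have Mz: "M *v z = t" by (simp add: M s)
  have "det M = \<sigma> 1 * \<sigma> 2 * \<sigma> 3 * det3 u v w"
    unfolding M_def det_transpose by (simp add: det_3 algebra_simps)
  then have "invertible M" using \<sigma> det by (simp add: invertible_det_nz)
  moreover have "z \<noteq> 0" using Mz t(1) by auto
  moreover have "z $ i = 0 \<or> z $ i = 1" for i by (simp add: z_def)
  ultimately show ?thesis
    using that[of M z] u v w t Mz \<sigma> by (simp add: M pt_scale)
qed

section \<open>Coordinates adapted to a partial isomorphism\<close>

text \<open>Degenerate triples are collinear in the domain and in the image, so the distinctness
  condition on the three points can be dropped.\<close>

lemma partial_iso_col_iff:
  assumes "partial_iso F3P2_points F3P2_lines Y f" "p \<in> Y" "q \<in> Y" "r \<in> Y"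
  shows "col p q r \<longleftrightarrow> col (f p) (f q) (f r)"
proof (cases "p \<noteq> q \<and> q \<noteq> r \<and> p \<noteq> r")
  case True
  then show ?thesis using assms unfolding partial_iso_def by blast
next
  case False
  have pair: "collinear_points F3P2_lines {s, t}" if "s \<in> F3P2_points" "t \<in> F3P2_points" for s t
    using collinear_pair[OF linear_space_F3P2 F3P2_lines_nonempty] that .
  have "p \<in> F3P2_points" "q \<in> F3P2_points" "r \<in> F3P2_points"
    "f p \<in> F3P2_points" "f q \<in> F3P2_points" "f r \<in> F3P2_points"
    using assms unfolding partial_iso_def by auto
  with False show ?thesis by (auto simp: pair insert_commute)
qed

text \<open>The matrices \<open>M\<close> and \<open>N\<close> are coordinate systems for the domain and for the image of \<open>f\<close>.
  The relation expresses \<open>f\<close> in these coordinates. It is a relation because the coordinates of a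
  point are determined only up to a scalar.\<close>

definition matched ::
    "(F3 ^ 3) set set \<Rightarrow> ((F3 ^ 3) set \<Rightarrow> (F3 ^ 3) set) \<Rightarrow> F3 ^ 3 ^ 3 \<Rightarrow> F3 ^ 3 ^ 3 \<Rightarrow>
     F3 ^ 3 \<Rightarrow> F3 ^ 3 \<Rightarrow> bool" where
  "matched Y f M N x x' \<longleftrightarrow> x \<noteq> 0 \<and> x' \<noteq> 0 \<and> pt (M *v x) \<in> Y \<and> f (pt (M *v x)) = pt (N *v x')"

lemma matched_det:
  assumes "partial_iso F3P2_points F3P2_lines Y f" "invertible M" "invertible N"
    and "matched Y f M N x x'" "matched Y f M N y y'" "matched Y f M N z z'"
  shows "det3 x y z = 0 \<longleftrightarrow> det3 x' y' z' = 0"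
  using assms partial_iso_col_iff[OF assms(1), of "pt (M *v x)" "pt (M *v y)" "pt (M *v z)"]
  unfolding matched_def by (simp add: collinear_matrix)

lemma matched_exists:
  assumes "partial_iso F3P2_points F3P2_lines Y f" "invertible M" "invertible N" "y \<in> Y"
  obtains x x' where "y = pt (M *v x)" "matched Y f M N x x'"
proof -
  have coord: "\<exists>x. x \<noteq> 0 \<and> p = pt (A *v x)" if A: "invertible A" and p: "p \<in> F3P2_points" for A p
  proof -
    obtain u where u: "u \<noteq> 0" "p = pt u" using p by (rule F3P2_point_span)
    obtain B where "A ** B = mat 1" using A unfolding invertible_def by blast
    then have "A *v (B *v u) = u" by (simp add: matrix_vector_mul_assoc)
    with u show ?thesis by (metis matrix_vector_mult_0_right)
  qed
  have "y \<in> F3P2_points" "f y \<in> F3P2_points"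
    using assms unfolding partial_iso_def by auto
  then obtain x x' where "x \<noteq> 0" "y = pt (M *v x)" "x' \<noteq> 0" "f y = pt (N *v x')"
    using coord assms(2,3) by metis
  with \<open>y \<in> Y\<close> show ?thesis using that unfolding matched_def by blast
qed

lemma e_nonzero: "e1 \<noteq> 0" "e2 \<noteq> 0" "e3 \<noteq> 0"
  by (simp_all add: vec3_eq_iff)

lemma det3_basis:
  fixes x z :: "F3 ^ 3"
  shows
  "det3 e1 e2 e3 = 1"
  "det3 e1 e2 x = x $ 3" "det3 e1 e3 x = - x $ 2" "det3 e2 e3 x = x $ 1"
  "det3 e1 z x = z $ 2 * x $ 3 - z $ 3 * x $ 2"
  "det3 e2 z x = z $ 3 * x $ 1 - z $ 1 * x $ 3"
  "det3 e3 z x = z $ 1 * x $ 2 - z $ 2 * x $ 1"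
  by (simp_all add: det_3)

text \<open>A coordinate vanishes exactly when the point lies on the corresponding side of the
  coordinate triangle.\<close>

lemma matched_zero_coords:
  assumes "partial_iso F3P2_points F3P2_lines Y f" "invertible M" "invertible N"
    and "matched Y f M N e1 e1" "matched Y f M N e2 e2" "matched Y f M N e3 e3"
    and "matched Y f M N x x'"
  shows "x $ i = 0 \<longleftrightarrow> x' $ i = 0"
  using matched_det[OF assms(1-3,4,5,7)] matched_det[OF assms(1-3,4,6,7)]
    matched_det[OF assms(1-3,5,6,7)] exhaust_3[of i]
  by (auto simp: det3_basis)

text \<open>Adapted frames are taken for \<open>a, b, c, d\<close> and for their images. Both fourth points
  have coordinates in \<open>{0, 1}\<close> with the same zeros, hence the same coordinate vector \<open>z\<close>. This is
  why a projective transformation can agree with \<open>f\<close> on four points at once.\<close>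

lemma matched_frames:
  assumes f: "partial_iso F3P2_points F3P2_lines Y f"
    and Y: "a \<in> Y" "b \<in> Y" "c \<in> Y" "d \<in> Y" and abc: "\<not> col a b c"
  obtains M N z where "invertible M" "invertible N"
    "a = pt (M *v e1)" "b = pt (M *v e2)" "c = pt (M *v e3)" "d = pt (M *v z)"
    "matched Y f M N e1 e1" "matched Y f M N e2 e2" "matched Y f M N e3 e3"
    "matched Y f M N z z" "\<And>i. z $ i = 0 \<or> z $ i = 1"
proof -
  have pts: "Y \<subseteq> F3P2_points" "f ` Y \<subseteq> F3P2_points"
    using f unfolding partial_iso_def by auto
  then have abcd: "a \<in> F3P2_points" "b \<in> F3P2_points" "c \<in> F3P2_points" "d \<in> F3P2_points"
    using Y by auto
  have fabcd: "f a \<in> F3P2_points" "f b \<in> F3P2_points" "f c \<in> F3P2_points" "f d \<in> F3P2_points"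
    using pts Y by auto
  obtain M z where M: "invertible M" "a = pt (M *v e1)" "b = pt (M *v e2)" "c = pt (M *v e3)"
    "d = pt (M *v z)" "z \<noteq> 0" and z: "\<And>i. z $ i = 0 \<or> z $ i = 1"
    using adapted_frame[OF abcd abc] by blast
  have "\<not> col (f a) (f b) (f c)" using partial_iso_col_iff[OF f Y(1-3)] abc by simp
  then obtain N z' where N: "invertible N" "f a = pt (N *v e1)" "f b = pt (N *v e2)"
    "f c = pt (N *v e3)" "f d = pt (N *v z')" "z' \<noteq> 0" and z': "\<And>i. z' $ i = 0 \<or> z' $ i = 1"
    using adapted_frame[OF fabcd] by blast
  have e: "matched Y f M N e1 e1" "matched Y f M N e2 e2" "matched Y f M N e3 e3"
    and zz': "matched Y f M N z z'"
    using M N Y e_nonzero unfolding matched_def by simp_all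
  have "z $ i = z' $ i" for i
    using matched_zero_coords[OF f M(1) N(1) e zz', of i] z[of i] z'[of i] by auto
  then have "z = z'" by (simp add: vec_eq_iff)
  then show ?thesis using that[OF M(1) N(1) M(2-5) e _ z] zz' by simp
qed

section \<open>Rigidity over the field with three elements\<close>

lemma F3_eq_uminus: "s \<noteq> 0 \<Longrightarrow> t \<noteq> 0 \<Longrightarrow> t \<noteq> s \<Longrightarrow> t = - (s :: F3)"
  by (cases s; cases t) (simp_all add: zero_finite_3_def uminus_finite_3_def)

text \<open>This is the place where the field must have three elements: relative to a fixed nonzero
  coordinate \<open>s\<close>, every coordinate is \<open>0\<close>, \<open>s\<close> or \<open>- s\<close>, so the equalities among coordinates
  and zero determine the vector up to a scalar. In the geometry these equalities say on which of
  the six lines through pairs of points of the standard quadrangle the point lies.\<close>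

lemma pt_eq_of_coords:
  fixes x x' :: "F3 ^ 3"
  assumes zero: "\<And>i. x $ i = 0 \<longleftrightarrow> x' $ i = 0"
    and eq: "\<And>i j. x $ i = x $ j \<longleftrightarrow> x' $ i = x' $ j"
  shows "pt x = pt x'"
proof (cases "x = 0")
  case True
  then have "x' = 0" using zero by (simp add: vec_eq_iff)
  with True show ?thesis by simp
next
  case False
  then obtain i where i: "x $ i \<noteq> 0" by (auto simp: vec_eq_iff)
  define k where "k = x' $ i / x $ i"
  have "k \<noteq> 0" and k: "x' $ i = k * x $ i" using i zero by (simp_all add: k_def)
  have "x' $ j = k * x $ j" for j
  proof -
    consider "x $ j = 0" | "x $ j = x $ i" | "x $ j \<noteq> 0" "x $ j \<noteq> x $ i" by blast
    then show ?thesis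
    proof cases
      case 1
      then show ?thesis using zero by simp
    next
      case 2
      then show ?thesis using eq k by metis
    next
      case 3
      then have "x $ j = - x $ i" "x' $ j = - x' $ i"
        using i zero eq by (auto intro!: F3_eq_uminus)
      then show ?thesis using k by simp
    qed
  qed
  then have "x' = k *s x" by (simp add: vec_eq_iff)
  then show ?thesis using pt_scale[OF \<open>k \<noteq> 0\<close>, of x] by simp
qed

text \<open>If \<open>f\<close> is the identity in the coordinates \<open>M\<close> and \<open>N\<close>, then it is given by the change of
  coordinates \<open>N ** matrix_inv M\<close>.\<close>

lemma projective_if_matched_pt_eq:
  assumes f: "partial_iso F3P2_points F3P2_lines Y f" and M: "invertible M" and N: "invertible N"
    and eq: "\<And>x x'. matched Y f M N x x' \<Longrightarrow> pt x = pt x'"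
  shows "\<exists>G. invertible G \<and> (\<forall>y\<in>Y. (*v) G ` y = f y)"
proof -
  obtain M' where M': "M ** M' = mat 1" "M' ** M = mat 1"
    using M unfolding invertible_def by blast
  have "invertible (N ** M')"
    using N M' invertible_mult unfolding invertible_def by blast
  moreover have "(*v) (N ** M') ` y = f y" if y: "y \<in> Y" for y
  proof -
    obtain x x' where x: "y = pt (M *v x)" "matched Y f M N x x'"
      using matched_exists[OF f M N y] by blast
    have "(*v) (N ** M') ` y = pt (N *v (M' *v (M *v x)))"
      by (simp add: x(1) matrix_pt matrix_vector_mul_assoc matrix_mul_assoc)
    also have "M' *v (M *v x) = x" by (simp add: matrix_vector_mul_assoc M')
    also have "pt (N *v x) = (*v) N ` pt x" by (simp add: matrix_pt)
    also have "\<dots> = pt (N *v x')" by (simp add: eq[OF x(2)] matrix_pt)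
    also have "\<dots> = f y" using x unfolding matched_def by simp
    finally show ?thesis .
  qed
  ultimately show ?thesis by blast
qed

section \<open>Partial isomorphisms with noncollinear domain\<close>

definition quadrangle :: "(F3 ^ 3) set \<Rightarrow> (F3 ^ 3) set \<Rightarrow> (F3 ^ 3) set \<Rightarrow> (F3 ^ 3) set \<Rightarrow> bool" where
  "quadrangle a b c d \<longleftrightarrow> \<not> col a b c \<and> \<not> col a b d \<and> \<not> col a c d \<and> \<not> col b c d"

lemma quadrangle_matrix:
  assumes "invertible M" "x \<noteq> 0" "y \<noteq> 0" "z \<noteq> 0" "w \<noteq> 0"
  shows "quadrangle (pt (M *v x)) (pt (M *v y)) (pt (M *v z)) (pt (M *v w)) \<longleftrightarrow>
    det3 x y z \<noteq> 0 \<and> det3 x y w \<noteq> 0 \<and> det3 x z w \<noteq> 0 \<and> det3 y z w \<noteq> 0"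
  using assms by (simp add: quadrangle_def collinear_matrix)

text \<open>Here \<open>z\<close> is the vector of ones. The lines that join it to the basis points are the
  loci where two coordinates agree, so every point of the domain has its coordinate equalities
  preserved and is fixed in coordinates.\<close>

lemma projective_if_quadrangle:
  assumes f: "partial_iso F3P2_points F3P2_lines Y f"
    and Y: "a \<in> Y" "b \<in> Y" "c \<in> Y" "d \<in> Y" and quad: "quadrangle a b c d"
  shows "\<exists>G. invertible G \<and> (\<forall>y\<in>Y. (*v) G ` y = f y)"
proof -
  have "\<not> col a b c" using quad unfolding quadrangle_def by simp
  then obtain M N z where M: "invertible M" and N: "invertible N"
    and abcd: "a = pt (M *v e1)" "b = pt (M *v e2)" "c = pt (M *v e3)" "d = pt (M *v z)"
    and e: "matched Y f M N e1 e1" "matched Y f M N e2 e2" "matched Y f M N e3 e3"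
    and z: "matched Y f M N z z" "\<And>i. z $ i = 0 \<or> z $ i = 1"
    using matched_frames[OF f Y] by blast
  have "z \<noteq> 0" using z(1) unfolding matched_def by simp
  then have "z $ 3 \<noteq> 0" "z $ 2 \<noteq> 0" "z $ 1 \<noteq> 0"
    using quad unfolding abcd by (simp_all add: quadrangle_matrix[OF M] e_nonzero det3_basis(1-4))
  then have z1: "z $ 1 = 1" "z $ 2 = 1" "z $ 3 = 1" using z(2) by metis+
  show ?thesis
  proof (rule projective_if_matched_pt_eq[OF f M N])
    fix x x' assume x: "matched Y f M N x x'"
    have "x $ 3 = x $ 2 \<longleftrightarrow> x' $ 3 = x' $ 2" "x $ 1 = x $ 3 \<longleftrightarrow> x' $ 1 = x' $ 3"
      "x $ 2 = x $ 1 \<longleftrightarrow> x' $ 2 = x' $ 1"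
      using matched_det[OF f M N e(1) z(1) x] matched_det[OF f M N e(2) z(1) x]
        matched_det[OF f M N e(3) z(1) x] by (simp_all add: det3_basis(5-7) z1)
    then have "x $ i = x $ j \<longleftrightarrow> x' $ i = x' $ j" for i j
      using exhaust_3[of i] exhaust_3[of j] by metis
    then show "pt x = pt x'"
      using pt_eq_of_coords matched_zero_coords[OF f M N e x] by blast
  qed
qed

text \<open>Here \<open>z\<close> has coordinates \<open>(1, 1, 0)\<close>. A point of the domain off the line \<open>a b\<close> and different
  from \<open>c\<close> would form a quadrangle with \<open>c\<close> and two of the points \<open>a, b, d\<close>. So all points other
  than \<open>c\<close> lie on the line \<open>a b\<close>, where the first two coordinates are under control.\<close>

lemma projective_if_no_quadrangle:
  assumes f: "partial_iso F3P2_points F3P2_lines Y f"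
    and Y: "a \<in> Y" "b \<in> Y" "c \<in> Y" "d \<in> Y" and abc: "\<not> col a b c"
    and abd: "col a b d" "d \<noteq> a" "d \<noteq> b"
    and no_quad: "\<And>p q r s. p \<in> Y \<Longrightarrow> q \<in> Y \<Longrightarrow> r \<in> Y \<Longrightarrow> s \<in> Y \<Longrightarrow> \<not> quadrangle p q r s"
  shows "\<exists>G. invertible G \<and> (\<forall>y\<in>Y. (*v) G ` y = f y)"
proof -
  obtain M N z where M: "invertible M" and N: "invertible N"
    and abcd: "a = pt (M *v e1)" "b = pt (M *v e2)" "c = pt (M *v e3)" "d = pt (M *v z)"
    and e: "matched Y f M N e1 e1" "matched Y f M N e2 e2" "matched Y f M N e3 e3"
    and z: "matched Y f M N z z" "\<And>i. z $ i = 0 \<or> z $ i = 1"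
    using matched_frames[OF f Y abc] by blast
  have "z \<noteq> 0" using z(1) unfolding matched_def by simp
  then have z3: "z $ 3 = 0"
    using abd(1) unfolding abcd by (simp add: collinear_matrix[OF M] e_nonzero det3_basis(1-4))
  have "z \<noteq> e1" "z \<noteq> e2" using abd(2,3) unfolding abcd by auto
  then have z12: "z $ 1 = 1" "z $ 2 = 1"
    using z(2)[of 1] z(2)[of 2] z3 \<open>z \<noteq> 0\<close> by (auto simp: vec3_eq_iff)
  show ?thesis
  proof (rule projective_if_matched_pt_eq[OF f M N])
    fix x x' assume x: "matched Y f M N x x'"
    then have "x \<noteq> 0" "pt (M *v x) \<in> Y" unfolding matched_def by auto
    \<comment> \<open>The three disjunctions exclude the quadrangles \<open>a b c x\<close>, \<open>c d a x\<close> and \<open>c d b x\<close>.\<close>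
    then have quads: "x $ 3 = 0 \<or> x $ 2 = 0 \<or> x $ 1 = 0"
        "x $ 3 = 0 \<or> x $ 2 = 0 \<or> x $ 2 = x $ 1"
        "x $ 3 = 0 \<or> x $ 1 = 0 \<or> x $ 2 = x $ 1"
      using no_quad[OF Y(1,2,3), of "pt (M *v x)"] no_quad[OF Y(3,4,1), of "pt (M *v x)"]
        no_quad[OF Y(3,4,2), of "pt (M *v x)"] \<open>z \<noteq> 0\<close> unfolding abcd
      by (auto simp: quadrangle_matrix[OF M] e_nonzero det_3 z3 z12)
    have zero: "x $ i = 0 \<longleftrightarrow> x' $ i = 0" for i
      by (rule matched_zero_coords[OF f M N e x])
    have "x $ 2 = x $ 1 \<longleftrightarrow> x' $ 2 = x' $ 1"
      using matched_det[OF f M N e(3) z(1) x] by (simp add: det3_basis(5-7) z12)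
    moreover have "x $ 3 = 0 \<or> x $ 1 = 0 \<and> x $ 2 = 0" using quads by metis
    then have "x $ 3 = x $ 1 \<longleftrightarrow> x' $ 3 = x' $ 1" "x $ 3 = x $ 2 \<longleftrightarrow> x' $ 3 = x' $ 2"
      using zero by metis+
    ultimately have "x $ i = x $ j \<longleftrightarrow> x' $ i = x' $ j" for i j
      using exhaust_3[of i] exhaust_3[of j] by metis
    then show "pt x = pt x'" using pt_eq_of_coords zero by blast
  qed
qed

lemma projective_if_triangle:
  assumes f: "partial_iso F3P2_points F3P2_lines {a, b, c} f" and abc: "\<not> col a b c"
  shows "\<exists>G. invertible G \<and> (\<forall>y\<in>{a, b, c}. (*v) G ` y = f y)"
proof -
  let ?Y = "{a, b, c}"
  obtain M N where M: "invertible M" and N: "invertible N"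
    and abc_eq: "a = pt (M *v e1)" "b = pt (M *v e2)" "c = pt (M *v e3)"
    and e: "matched ?Y f M N e1 e1" "matched ?Y f M N e2 e2" "matched ?Y f M N e3 e3"
    using matched_frames[OF f, of a b c a] abc by blast
  obtain M' where M': "M ** M' = mat 1" "M' ** M = mat 1"
    using M unfolding invertible_def by blast
  have "invertible (N ** M')"
    using N M' invertible_mult unfolding invertible_def by blast
  moreover have "(*v) (N ** M') ` pt (M *v x) = pt (N *v x)" for x
    by (simp add: matrix_pt matrix_vector_mul_assoc M' flip: matrix_mul_assoc)
  ultimately show ?thesis using e unfolding matched_def abc_eq by auto
qed

text \<open>If there is a point \<open>d\<close> besides a triangle \<open>a, b, c\<close> but no quadrangle, then \<open>d\<close> lies on a
  side of the triangle, and relabelling makes it the side \<open>a b\<close>.\<close>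

lemma projective_if_noncollinear:
  assumes f: "partial_iso F3P2_points F3P2_lines Y f" and "\<not> collinear_points F3P2_lines Y"
  shows "\<exists>G. invertible G \<and> (\<forall>y\<in>Y. (*v) G ` y = f y)"
proof (cases "\<exists>a\<in>Y. \<exists>b\<in>Y. \<exists>c\<in>Y. \<exists>d\<in>Y. quadrangle a b c d")
  case True
  then show ?thesis using projective_if_quadrangle[OF f] by blast
next
  case False
  then have no_quad: "\<not> quadrangle a b c d" if "a \<in> Y" "b \<in> Y" "c \<in> Y" "d \<in> Y" for a b c d
    using that by blast
  have "Y \<subseteq> F3P2_points" using f unfolding partial_iso_def by simp
  then obtain a b c where Y: "a \<in> Y" "b \<in> Y" "c \<in> Y" and abc: "\<not> col a b c"
    using collinear_of_triples[OF linear_space_F3P2 F3P2_lines_nonempty] assms(2) by metis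
  show ?thesis
  proof (cases "Y = {a, b, c}")
    case True
    then show ?thesis using projective_if_triangle f abc by blast
  next
    case False
    then obtain d where d: "d \<in> Y" "d \<noteq> a" "d \<noteq> b" "d \<noteq> c" using Y by blast
    have near: ?thesis if "p \<in> Y" "q \<in> Y" "r \<in> Y" "\<not> col p q r" "col p q d" "d \<noteq> p" "d \<noteq> q"
      for p q r
      by (rule projective_if_no_quadrangle[OF f that(1-3) d(1) that(4-7)]) (rule no_quad)
    have "{a, c, b} = {a, b, c}" "{b, c, a} = {a, b, c}" by auto
    then have "\<not> col a c b" "\<not> col b c a" using abc by simp_all
    moreover have "col a b d \<or> col a c d \<or> col b c d"
      using no_quad[OF Y d(1)] abc unfolding quadrangle_def by blast
    ultimately show ?thesis
      using near[OF Y abc] near[of a c b] near[of b c a] Y d by blast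
  qed
qed

lemma F3P2_noncollinear: "\<not> collinear_points F3P2_lines F3P2_points"
proof
  assume "collinear_points F3P2_lines F3P2_points"
  then have "col (pt e1) (pt e2) (pt e3)"
    using F3P2_span_point e_nonzero unfolding collinear_points_def
    by (meson empty_subsetI insert_subset subsetD)
  then show False by (simp add: collinear_iff_det e_nonzero det3_basis(1))
qed

section \<open>Homogeneity\<close>

theorem corollary3p7:
  shows "homogeneous_linear_space F3P2_points F3P2_lines"
  unfolding homogeneous_linear_space_def
proof (intro allI impI)
  fix Y Z f
  assume "Y \<subseteq> F3P2_points \<and> finite Y \<and> Z \<subseteq> F3P2_points \<and> finite Z \<and>
    linear_space_iso Y (subspace_lines F3P2_lines Y) Z (subspace_lines F3P2_lines Z) f"
  then have f: "partial_iso F3P2_points F3P2_lines Y f"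
    using linear_space_iso_imp_partial_iso by blast
  obtain Y' f' where Y': "Y \<subseteq> Y'" "\<forall>y\<in>Y. f' y = f y"
    and f': "partial_iso F3P2_points F3P2_lines Y' f'" "\<not> collinear_points F3P2_lines Y'"
    using partial_iso_extend_noncollinear[OF linear_space_F3P2 F3P2_noncollinear finite f] by blast
  obtain G where "invertible G" "\<forall>y\<in>Y'. (*v) G ` y = f' y"
    using projective_if_noncollinear[OF f'] by blast
  then show "\<exists>g. linear_space_iso F3P2_points F3P2_lines F3P2_points F3P2_lines g \<and>
      (\<forall>y\<in>Y. g y = f y)"
    using matrix_automorphism Y' by (metis subsetD)
qed

end
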